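(* The relation $E^{ce}_{\mathrm{set}}$ is finitarily reducible to $E^{ce}_3$, i.e. $E^{ce}_{\mathrm{set}}\leq_c^{<\omega}E^{ce}_3$.
   Context: $W_e$ is the $e$-th c.e. set. For $A\subseteq\omega$ and $n\in\omega$, $A^{[n]}=\{x:\langle x,n\rangle\in A\}$ is the $n$-th column of $A$, where $\langle\cdot,\cdot\rangle$ is the standard computable pairing function. $i\,E^{ce}_{\mathrm{set}}\,j\iff\{W_i^{[n]}:n\in\omega\}=\{W_j^{[n]}:n\in\omega\}$, and $i\,E^{ce}_3\,j\iff$ for every $n$, the symmetric difference $W_i^{[n]}\triangle W_j^{[n]}$ is finite. For equivalence relations $E,F$ on $\omega$, $E\leq_c^{<\omega}F$ means there is a single total computable function which, given $n\ge1$ and an $n$-tuple $(x_0,\dots,x_{n-1})$, outputs an $n$-tuple $(y_0,\dots,y_{n-1})$ with $x_i\,E\,x_j\iff y_i\,F\,y_j$ for all $i<j<n$. *)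

theory Defs
  imports Main "HOL-Library.Nat_Bijection"
begin

datatype recf =
    Z
  | S
  | Proj nat
  | Comp recf "recf list"
  | Prim recf recf
  | Mu recf

inductive eval :: "recf \<Rightarrow> nat list \<Rightarrow> nat \<Rightarrow> bool" where
  eval_Z: "eval Z xs 0"
| eval_S: "eval S (x # xs) (Suc x)"
| eval_Proj: "i < length xs \<Longrightarrow> eval (Proj i) xs (xs ! i)"
| eval_Comp: "list_all2 (\<lambda>g y. eval g xs y) gs ys \<Longrightarrow> eval f ys z \<Longrightarrow> eval (Comp f gs) xs z"
| eval_Prim0: "eval g xs y \<Longrightarrow> eval (Prim g h) (0 # xs) y"
| eval_PrimS: "eval (Prim g h) (n # xs) y \<Longrightarrow> eval h (n # y # xs) z
                 \<Longrightarrow> eval (Prim g h) (Suc n # xs) z"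
| eval_Mu: "eval f (n # xs) 0 \<Longrightarrow> (\<forall>m<n. \<exists>y. 0 < y \<and> eval f (m # xs) y)
              \<Longrightarrow> eval (Mu f) xs n"

fun enc :: "recf \<Rightarrow> nat" where
  "enc Z = prod_encode (0, 0)"
| "enc S = prod_encode (1, 0)"
| "enc (Proj i) = prod_encode (2, i)"
| "enc (Comp f gs) = prod_encode (3, prod_encode (enc f, list_encode (map enc gs)))"
| "enc (Prim g h) = prod_encode (4, prod_encode (enc g, enc h))"
| "enc (Mu f) = prod_encode (5, enc f)"

definition prog :: "nat \<Rightarrow> recf" where
  "prog e = (if \<exists>f. enc f = e then (THE f. enc f = e) else Z)"

definition W :: "nat \<Rightarrow> nat set" where
  "W e = {x. \<exists>y. eval (prog e) [x] y}"

definition computable :: "(nat \<Rightarrow> nat) \<Rightarrow> bool" where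
  "computable g \<longleftrightarrow> (\<exists>p. \<forall>x. eval p [x] (g x))"

definition column :: "nat set \<Rightarrow> nat \<Rightarrow> nat set" where
  "column A n = {x. prod_encode (x, n) \<in> A}"

definition E_set_ce :: "nat \<Rightarrow> nat \<Rightarrow> bool" where
  "E_set_ce i j \<longleftrightarrow> range (column (W i)) = range (column (W j))"

definition E3_ce :: "nat \<Rightarrow> nat \<Rightarrow> bool" where
  "E3_ce i j \<longleftrightarrow> (\<forall>n. finite ((column (W i) n - column (W j) n) \<union> (column (W j) n - column (W i) n)))"

definition fin_reducible :: "(nat \<Rightarrow> nat \<Rightarrow> bool) \<Rightarrow> (nat \<Rightarrow> nat \<Rightarrow> bool) \<Rightarrow> bool" where
  "fin_reducible E F \<longleftrightarrow>
     (\<exists>g. computable g \<and>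
        (\<forall>xs. xs \<noteq> [] \<longrightarrow>
           (let ys = list_decode (g (list_encode xs)) in
              length ys = length xs \<and>
              (\<forall>i j. i < j \<and> j < length xs \<longrightarrow> (E (xs ! i) (xs ! j) \<longleftrightarrow> F (ys ! i) (ys ! j))))))"

end

theory Submission
  imports Defs "HOL-Library.Infinite_Set"
begin

text \<open>
  Call \<open>(a, b, m, p)\<close> a true event if the \<open>m\<close>-th column of \<open>W\<^sub>a\<close> equals the \<open>p\<close>-th column of
  \<open>W\<^sub>b\<close>. Being true is \<open>\<Pi>\<^sub>2\<close>, hence equivalent to firing at infinitely many stages of a decidable
  process. Two indices are equivalent for \<open>E_set_ce\<close> iff, for every \<open>k\<close>, each column
  of either one with number at most \<open>k\<close> is matched by a true event. For a fixed finite list of indices, let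
  \<open>\<sim>\<^sub>k\<close> be the transitive closure of this \<open>k\<close>-th condition on the list: each \<open>\<sim>\<^sub>k\<close> is a \<open>\<Sigma>\<^sub>3\<close>
  equivalence relation, \<open>E_set_ce\<close> implies all of them, and by finiteness it coincides with
  \<open>\<sim>\<^sub>k\<close> for large \<open>k\<close>.

  The \<open>k\<close>-th column of the \<open>i\<close>-th output set reduces \<open>\<sim>\<^sub>k\<close> to equality up to finite sets. Its
  elements are guesses \<open>(r, F, t, q)\<close>: the true events up to \<open>r\<close> all lie in \<open>F\<close>, and \<open>t\<close> is the
  last stage at which one of the events up to \<open>r\<close> outside \<open>F\<close> fires. A guess is enumerated
  into every output set once it is refuted, and into the \<open>i\<close>-th one also if the events in \<open>F\<close>
  connect \<open>i\<close> with \<open>q\<close>. If \<open>i \<sim>\<^sub>k j\<close> is witnessed by true events up to \<open>e\<close>, the sets differ only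
  at surviving guesses with \<open>r < e\<close>, and those are finitely many; otherwise the correct guess
  with \<open>q = i\<close> distinguishes \<open>i\<close> from \<open>j\<close> for every \<open>r\<close>.
\<close>

section \<open>Computable functions and decidable predicates\<close>

inductive_cases eval_ZE: "eval Z xs y"
  and eval_SE: "eval S xs y"
  and eval_ProjE: "eval (Proj i) xs y"
  and eval_CompE: "eval (Comp f gs) xs y"
  and eval_Prim0E: "eval (Prim g h) (0 # xs) y"
  and eval_PrimSE: "eval (Prim g h) (Suc n # xs) y"
  and eval_MuE: "eval (Mu f) xs y"

lemma eval_functional: "eval f xs y \<Longrightarrow> eval f xs z \<Longrightarrow> y = z"
proof (induction arbitrary: z rule: eval.induct)
  case (eval_Comp xs gs ys f z')
  from eval_Comp.prems obtain ys' where
    ys': "list_all2 (\<lambda>g y. eval g xs y) gs ys'" "eval f ys' z"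
    by (rule eval_CompE)
  have "ys = ys'"
    using eval_Comp.IH(1) ys'(1) by (auto simp: list_all2_conv_all_nth intro!: nth_equalityI)
  with ys'(2) eval_Comp.IH(2) show ?case by simp
next
  case (eval_Mu f n xs)
  from eval_Mu.prems have z: "eval f (z # xs) 0" "\<forall>m<z. \<exists>y. 0 < y \<and> eval f (m # xs) y"
    by (rule eval_MuE, blast)+
  \<comment> \<open>At \<open>n\<close> the search function has value 0, whereas stopping later at
    \<open>z\<close> would require a positive value there; the converse case is symmetric.\<close>
  have "\<not> n < z" using z(2) eval_Mu.IH(1) by fastforce
  moreover have "\<not> z < n" using z(1) eval_Mu.IH(2) by fastforce
  ultimately show ?case by simp
next
  case (eval_PrimS g h n xs y z')
  from eval_PrimS.prems obtain y' where "eval (Prim g h) (n # xs) y'" "eval h (n # y' # xs) z"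
    by (rule eval_PrimSE)
  then show ?case using eval_PrimS.IH by metis
next
  case (eval_Prim0 g xs y h)
  from eval_Prim0.prems have "eval g xs z" by (rule eval_Prim0E)
  then show ?case by (rule eval_Prim0.IH)
qed (erule eval_ZE eval_SE eval_ProjE; simp)+

lemma eval_Comp1: "eval g xs y \<Longrightarrow> eval f [y] z \<Longrightarrow> eval (Comp f [g]) xs z"
  by (rule eval_Comp[where ys = "[y]"]) auto

lemma eval_Comp2:
  "eval g xs y \<Longrightarrow> eval g' xs y' \<Longrightarrow> eval f [y, y'] z \<Longrightarrow> eval (Comp f [g, g']) xs z"
  by (rule eval_Comp[where ys = "[y, y']"]) auto

lemma eval_Proj_0: "eval (Proj 0) (x # xs) x"
  using eval_Proj[of 0 "x # xs"] by simp

lemma eval_Proj_1: "eval (Proj (Suc 0)) (x # y # xs) y"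
  using eval_Proj[of "Suc 0" "x # y # xs"] by simp

text \<open>Only arities one and two get a predicate; further parameters are packed into one number
  by pairing.\<close>

definition computable2 :: "(nat \<Rightarrow> nat \<Rightarrow> nat) \<Rightarrow> bool" where
  "computable2 h \<longleftrightarrow> (\<exists>p. \<forall>x y. eval p [x, y] (h x y))"

named_theorems computable_intros

lemma computable_compose: "computable f \<Longrightarrow> computable g \<Longrightarrow> computable (\<lambda>x. f (g x))"
  unfolding computable_def by (meson eval_Comp1)

lemma computable2_compose:
  "computable2 h \<Longrightarrow> computable f \<Longrightarrow> computable g \<Longrightarrow> computable (\<lambda>x. h (f x) (g x))"
  unfolding computable_def computable2_def by (meson eval_Comp2)

lemma computable2_compose2:
  "computable2 h \<Longrightarrow> computable2 f \<Longrightarrow> computable2 g \<Longrightarrow> computable2 (\<lambda>x y. h (f x y) (g x y))"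
  unfolding computable2_def by (meson eval_Comp2)

lemma computable_compose2: "computable f \<Longrightarrow> computable2 g \<Longrightarrow> computable2 (\<lambda>x y. f (g x y))"
  unfolding computable_def computable2_def by (meson eval_Comp1)

lemma computable2_fst: "computable2 (\<lambda>x y. x)" and computable2_snd: "computable2 (\<lambda>x y. y)"
  unfolding computable2_def using eval_Proj_0 eval_Proj_1 by blast+

lemma computable_id [computable_intros]: "computable (\<lambda>x. x)"
  unfolding computable_def using eval_Proj_0 by blast

lemma computable_Suc: "computable Suc"
  unfolding computable_def using eval_S by blast

primrec const_prog :: "nat \<Rightarrow> recf" where
  "const_prog 0 = Z"
| "const_prog (Suc c) = Comp S [const_prog c]"

lemma eval_const_prog: "eval (const_prog c) xs c"
  by (induction c) (auto intro: eval_Z eval_S eval_Comp1)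

lemma computable_const [computable_intros]: "computable (\<lambda>x. c)"
  unfolding computable_def using eval_const_prog by blast

lemma computable2_add: "computable2 (+)"
proof -
  have "eval (Prim (Proj 0) (Comp S [Proj 1])) [n, x] (n + x)" for n x
    by (induction n) (auto intro!: eval_Prim0 eval_Proj_0 intro: eval_PrimS eval_Comp1 eval_Proj_1 eval_S)
  then show ?thesis unfolding computable2_def by blast
qed

lemma computable_pred: "computable (\<lambda>n. n - 1)"
proof -
  have "eval (Prim Z (Proj 0)) [n] (n - 1)" for n
  proof (induction n)
    case (Suc n)
    show ?case using eval_PrimS[OF Suc eval_Proj_0] by simp
  qed (auto intro: eval_Prim0 eval_Z)
  then show ?thesis unfolding computable_def by blast
qed

lemma computable2_diff: "computable2 (-)"
proof -
  obtain p where p: "\<And>n. eval p [n] (n - 1)" using computable_pred unfolding computable_def by blast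
  have "eval (Prim (Proj 0) (Comp p [Proj 1])) [n, x] (x - n)" for n x
  proof (induction n)
    case (Suc n)
    have "eval (Comp p [Proj 1]) [n, x - n, x] (x - n - 1)"
      by (rule eval_Comp1[OF _ p]) (simp add: eval_Proj_1)
    from eval_PrimS[OF Suc this] show ?case by simp
  qed (auto intro: eval_Prim0 eval_Proj_0)
  \<comment> \<open>\<open>Prim\<close> recurses on its first argument, here the subtrahend;
    swapping the arguments restores the usual order.\<close>
  then have "computable2 (\<lambda>n x. x - n)" unfolding computable2_def by blast
  from computable2_compose2[OF this computable2_snd computable2_fst] show ?thesis by simp
qed

lemma computable_triangle: "computable triangle"
proof -
  obtain p where p: "\<And>x y. eval p [x, y] (Suc x + y)"
    using computable2_compose2[OF computable2_add computable_compose2[OF computable_Suc computable2_fst] computable2_snd]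
    unfolding computable2_def by blast
  have "eval (Prim Z p) [n] (triangle n)" for n
  proof (induction n)
    case (Suc n)
    show ?case using eval_PrimS[OF Suc p] by (simp add: add.commute)
  qed (auto intro: eval_Prim0 eval_Z)
  then show ?thesis unfolding computable_def by blast
qed

lemma computable2_prod_encode: "computable2 (\<lambda>x y. prod_encode (x, y))"
  using computable2_compose2[OF computable2_add computable_compose2[OF computable_triangle computable2_add] computable2_fst]
  by (simp add: prod_encode_def)

text \<open>Iteration is the form of recursion on which list access, binary digits, powers of two
  and codes of constant programs are built.\<close>

lemma computable2_funpow:
  assumes "computable g" shows "computable2 (\<lambda>n x. (g ^^ n) x)"
proof -
  obtain p where p: "\<And>x. eval p [x] (g x)" using assms unfolding computable_def by blast
  have "eval (Prim (Proj 0) (Comp p [Proj 1])) [n, x] ((g ^^ n) x)" for n x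
    using p by (induction n) (auto intro: eval_Prim0 eval_Proj_0 eval_PrimS eval_Comp1 eval_Proj_1)
  then show ?thesis unfolding computable2_def by blast
qed

lemma computable2_Least_zero:
  assumes "computable2 f" and ex: "\<And>x. \<exists>n. f n x = 0"
  shows "computable (\<lambda>x. LEAST n. f n x = 0)"
proof -
  obtain p where p: "\<And>x y. eval p [x, y] (f x y)" using assms unfolding computable2_def by blast
  have "eval (Mu p) [x] (LEAST n. f n x = 0)" for x
  proof (rule eval_Mu)
    show "eval p [LEAST n. f n x = 0, x] 0"
      using p[of "LEAST n. f n x = 0" x] LeastI_ex[OF ex[of x]] by simp
    show "\<forall>m<LEAST n. f n x = 0. \<exists>y. 0 < y \<and> eval p [m, x] y"
      using p not_less_Least by blast
  qed
  then show ?thesis unfolding computable_def by blast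
qed

section \<open>Inverting the pairing function\<close>

definition pfst :: "nat \<Rightarrow> nat" where "pfst z = fst (prod_decode z)"
definition psnd :: "nat \<Rightarrow> nat" where "psnd z = snd (prod_decode z)"

lemma pfst_prod_encode [simp]: "pfst (prod_encode (a, b)) = a"
  and psnd_prod_encode [simp]: "psnd (prod_encode (a, b)) = b"
  and prod_encode_pfst_psnd [simp]: "prod_encode (pfst z, psnd z) = z"
  by (simp_all add: pfst_def psnd_def)

lemma ex_prod_encode: "\<exists>a b. z = prod_encode (a, b)"
  by (metis prod_encode_pfst_psnd)

lemma triangle_mono: "m \<le> n \<Longrightarrow> triangle m \<le> triangle n"
  by (induction rule: dec_induct) auto

text \<open>The code of (a, b) is \<open>triangle (a + b) + a\<close>, so \<open>z\<close> lies on
  diagonal a + b, the first one with \<open>z < triangle (Suc w)\<close>; truncated subtraction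
  turns this inequality into a zero test.\<close>

lemma Least_triangle: "(LEAST w. Suc z - triangle (Suc w) = 0) = pfst z + psnd z"
proof -
  obtain a b where z: "z = prod_encode (a, b)" using ex_prod_encode by blast
  show ?thesis
  proof (rule Least_equality)
    fix w assume "Suc z - triangle (Suc w) = 0"
    then have "triangle (a + b) < triangle (Suc w)" by (simp add: z prod_encode_def)
    then have "\<not> Suc w \<le> a + b" using triangle_mono[of "Suc w" "a + b"] by linarith
    then show "pfst z + psnd z \<le> w" by (simp add: z)
  qed (simp add: z, simp add: prod_encode_def)
qed

lemma computable_psum: "computable (\<lambda>z. pfst z + psnd z)"
proof -
  have 1: "computable2 (\<lambda>w z. Suc z - triangle (Suc w))"
    by (intro computable2_compose2[OF computable2_diff] computable_compose2[OF computable_Suc]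
        computable_compose2[OF computable_triangle] computable2_fst computable2_snd)
  have "\<exists>w. Suc z - triangle (Suc w) = 0" for z
    by (rule exI[of _ z]) simp
  from computable2_Least_zero[OF 1 this] show ?thesis by (simp only: Least_triangle)
qed

lemma computable_pfst: "computable pfst"
proof -
  have "z - triangle (pfst z + psnd z) = pfst z" for z
  proof -
    obtain a b where z: "z = prod_encode (a, b)" using ex_prod_encode by blast
    then have "z = triangle (a + b) + a" by (simp add: prod_encode_def)
    with z show ?thesis by (metis add_diff_cancel_left' pfst_prod_encode psnd_prod_encode)
  qed
  moreover have "computable (\<lambda>z. z - triangle (pfst z + psnd z))"
    by (intro computable2_compose[OF computable2_diff] computable_id
        computable_compose[OF computable_triangle] computable_psum)
  ultimately show ?thesis by simp
qed

lemma computable_psnd: "computable psnd"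
  using computable2_compose[OF computable2_diff computable_psum computable_pfst] by simp

lemmas computable_basic [computable_intros] =
  computable_compose[OF computable_Suc] computable_compose[OF computable_pfst]
  computable_compose[OF computable_psnd] computable2_compose[OF computable2_prod_encode]
  computable2_compose[OF computable2_add] computable2_compose[OF computable2_diff]

lemma computable2_pair:
  assumes "computable (\<lambda>z. h (pfst z) (psnd z))" shows "computable2 h"
  using computable_compose2[OF assms computable2_prod_encode] by simp

lemma computable_funpow [computable_intros]:
  "computable g \<Longrightarrow> computable f \<Longrightarrow> computable h \<Longrightarrow> computable (\<lambda>x. (g ^^ f x) (h x))"
  by (rule computable2_compose[OF computable2_funpow])

text \<open>Truth is coded by \<open>0\<close>, so that minimisation searches for a witness.\<close>

definition decidable :: "(nat \<Rightarrow> bool) \<Rightarrow> bool" where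
  "decidable P \<longleftrightarrow> computable (\<lambda>x. if P x then 0 else 1)"

lemma decidable_zero: "computable f \<Longrightarrow> decidable (\<lambda>x. f x = 0)"
proof -
  assume "computable f"
  then have "computable (\<lambda>x. 1 - (1 - f x))" by (intro computable_intros)
  moreover have "1 - (1 - f x) = (if f x = 0 then 0 else 1)" for x by simp
  ultimately show ?thesis unfolding decidable_def by simp
qed

lemma decidable_le [computable_intros]:
  "computable f \<Longrightarrow> computable g \<Longrightarrow> decidable (\<lambda>x. f x \<le> g x)"
  using decidable_zero[of "\<lambda>x. f x - g x"] by (auto intro: computable_intros)

lemma decidable_not [computable_intros]: "decidable P \<Longrightarrow> decidable (\<lambda>x. \<not> P x)"
proof -
  assume "decidable P"
  then have "computable (\<lambda>x. 1 - (if P x then 0 else 1))" unfolding decidable_def by (intro computable_intros)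
  moreover have "1 - (if P x then 0 else 1) = (if \<not> P x then 0 else (1::nat))" for x by simp
  ultimately show ?thesis unfolding decidable_def by simp
qed

lemma decidable_conj [computable_intros]:
  "decidable P \<Longrightarrow> decidable Q \<Longrightarrow> decidable (\<lambda>x. P x \<and> Q x)"
proof -
  assume "decidable P" "decidable Q"
  then have "decidable (\<lambda>x. (if P x then 0 else 1) + (if Q x then 0 else (1::nat)) = 0)"
    unfolding decidable_def[of P] decidable_def[of Q] by (intro decidable_zero computable_intros)
  moreover have "(if P x then 0 else 1) + (if Q x then 0 else (1::nat)) = 0 \<longleftrightarrow> P x \<and> Q x" for x by simp
  ultimately show ?thesis by simp
qed

lemma decidable_disj [computable_intros]:
  "decidable P \<Longrightarrow> decidable Q \<Longrightarrow> decidable (\<lambda>x. P x \<or> Q x)"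
  using decidable_not[OF decidable_conj[OF decidable_not decidable_not]] by simp

lemma decidable_imp [computable_intros]:
  "decidable P \<Longrightarrow> decidable Q \<Longrightarrow> decidable (\<lambda>x. P x \<longrightarrow> Q x)"
  unfolding imp_conv_disj by (intro decidable_disj decidable_not)

lemma decidable_iff [computable_intros]:
  "decidable P \<Longrightarrow> decidable Q \<Longrightarrow> decidable (\<lambda>x. P x \<longleftrightarrow> Q x)"
  unfolding iff_conv_conj_imp by (intro decidable_conj decidable_imp)

lemma decidable_eq [computable_intros]:
  "computable f \<Longrightarrow> computable g \<Longrightarrow> decidable (\<lambda>x. f x = g x)"
  unfolding eq_iff[of "f _"] by (intro decidable_conj decidable_le)

lemma decidable_less [computable_intros]:
  "computable f \<Longrightarrow> computable g \<Longrightarrow> decidable (\<lambda>x. f x < g x)"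
  unfolding not_le[symmetric] by (intro decidable_not decidable_le)

lemma decidable_compose: "decidable P \<Longrightarrow> computable f \<Longrightarrow> decidable (\<lambda>x. P (f x))"
  unfolding decidable_def by (rule computable_compose)

lemma computable_Least:
  assumes "decidable (\<lambda>z. P (pfst z) (psnd z))" and ex: "\<And>x. \<exists>n. P n x"
  shows "computable (\<lambda>x. LEAST n. P n x)"
proof -
  have "computable2 (\<lambda>n x. if P n x then 0 else 1)"
    using assms(1) unfolding decidable_def by (rule computable2_pair)
  then have "computable (\<lambda>x. LEAST n. (if P n x then 0 else 1) = (0::nat))"
    by (rule computable2_Least_zero) (use ex in auto)
  moreover have "(if P n x then 0 else 1) = (0::nat) \<longleftrightarrow> P n x" for n x by simp
  ultimately show ?thesis by simp
qed

text \<open>The search for a witness is cut off at the bound, so it always terminates; a witness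
  exists iff it stops earlier.\<close>

lemma decidable_bex [computable_intros]:
  assumes "computable b" and "decidable (\<lambda>z. P (pfst z) (psnd z))"
  shows "decidable (\<lambda>x. \<exists>n<b x. P n x)"
proof -
  have "decidable (\<lambda>z. b (psnd z) \<le> pfst z \<or> P (pfst z) (psnd z))"
    by (intro computable_intros computable_compose[OF assms(1)] assms(2))
  then have "computable (\<lambda>x. LEAST n. b x \<le> n \<or> P n x)"
    by (rule computable_Least) blast
  then have "decidable (\<lambda>x. (LEAST n. b x \<le> n \<or> P n x) < b x)"
    by (intro computable_intros assms(1))
  moreover have "(LEAST n. b x \<le> n \<or> P n x) < b x \<longleftrightarrow> (\<exists>n<b x. P n x)" for x
  proof
    assume l: "(LEAST n. b x \<le> n \<or> P n x) < b x"
    have "b x \<le> (LEAST n. b x \<le> n \<or> P n x) \<or> P (LEAST n. b x \<le> n \<or> P n x) x"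
      by (rule LeastI[of _ "b x"]) simp
    with l show "\<exists>n<b x. P n x" by auto
  next
    assume "\<exists>n<b x. P n x"
    then obtain n where "n < b x" "P n x" by blast
    then show "(LEAST n. b x \<le> n \<or> P n x) < b x"
      using Least_le[of "\<lambda>n. b x \<le> n \<or> P n x" n] by simp
  qed
  ultimately show ?thesis by simp
qed

lemma decidable_ball [computable_intros]:
  assumes "computable b" and "decidable (\<lambda>z. P (pfst z) (psnd z))"
  shows "decidable (\<lambda>x. \<forall>n<b x. P n x)"
  using decidable_not[OF decidable_bex[OF assms(1) decidable_not[OF assms(2)]]] by simp

section \<open>Lists coded by numbers\<close>

definition lhd :: "nat \<Rightarrow> nat" where "lhd l = pfst (l - 1)"
definition ltl :: "nat \<Rightarrow> nat" where "ltl l = psnd (l - 1)"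
definition lnth :: "nat \<Rightarrow> nat \<Rightarrow> nat" where "lnth l i = lhd ((ltl ^^ i) l)"

lemma lhd_Suc [simp]: "lhd (Suc (prod_encode (a, l))) = a"
  and ltl_Suc [simp]: "ltl (Suc (prod_encode (a, l))) = l"
  by (simp_all add: lhd_def ltl_def)

text \<open>Truncated subtraction makes the empty list its own tail, so iterating \<open>ltl\<close>
  beyond the end is harmless.\<close>

lemma ltl_0 [simp]: "ltl 0 = 0"
  using le_prod_encode_2[of "psnd 0" "pfst 0"] by (simp add: ltl_def)

lemma ltl_list_encode: "ltl (list_encode xs) = list_encode (tl xs)"
  by (cases xs) simp_all

lemma funpow_ltl: "(ltl ^^ n) (list_encode xs) = list_encode (drop n xs)"
  by (induction n) (simp_all add: ltl_list_encode drop_Suc tl_drop)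

lemma list_encode_eq_0 [simp]: "list_encode xs = 0 \<longleftrightarrow> xs = []"
  by (cases xs) simp_all

lemma lnth_list_encode [simp]: "i < length xs \<Longrightarrow> lnth (list_encode xs) i = xs ! i"
  by (simp add: lnth_def funpow_ltl Cons_nth_drop_Suc[symmetric])

lemma lnth_eq: "i < length (list_decode l) \<Longrightarrow> lnth l i = list_decode l ! i"
  using lnth_list_encode[of i "list_decode l"] by simp

lemma length_list_decode: "length (list_decode l) = (LEAST k. (ltl ^^ k) l = 0)"
  using funpow_ltl[of _ "list_decode l"] by (auto intro!: Least_equality[symmetric])

lemma computable_lhd: "computable lhd" and computable_ltl: "computable ltl"
  unfolding lhd_def ltl_def by (intro computable_intros)+

lemma computable_lnth [computable_intros]:
  "computable f \<Longrightarrow> computable g \<Longrightarrow> computable (\<lambda>x. lnth (f x) (g x))"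
  unfolding lnth_def by (intro computable_compose[OF computable_lhd] computable_intros computable_ltl)

lemma computable_length: "computable (\<lambda>l. length (list_decode l))"
  unfolding length_list_decode
proof (rule computable_Least)
  show "decidable (\<lambda>z. (ltl ^^ pfst z) (psnd z) = 0)"
    by (intro computable_intros computable_ltl)
  show "\<exists>n. (ltl ^^ n) l = 0" for l
    using funpow_ltl[of "length (list_decode l)" "list_decode l"] by auto
qed

lemmas computable_list [computable_intros] =
  computable_compose[OF computable_lhd] computable_compose[OF computable_ltl]
  computable_compose[OF computable_length]

section \<open>Finite sets coded in binary\<close>

lemma computable_half: "computable (\<lambda>n. n div 2)"
proof -
  have "decidable (\<lambda>z. psnd z < Suc (pfst z) + Suc (pfst z))" by (intro computable_intros)
  then have "computable (\<lambda>n. LEAST q. n < Suc q + Suc q)"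
    by (rule computable_Least) (use less_add_Suc1 in blast)
  moreover have "(LEAST q. n < Suc q + Suc q) = n div 2" for n :: nat
    by (rule Least_equality) auto
  ultimately show ?thesis by simp
qed

text \<open>Binary digit \<open>x\<close> is the parity after \<open>x\<close> halvings, and a
  number is odd iff it is not twice its half.\<close>

lemma mem_set_decode_iff:
  "x \<in> set_decode s \<longleftrightarrow> ((\<lambda>n. n div 2) ^^ x) s \<noteq> ((\<lambda>n. n div 2) ^^ Suc x) s + ((\<lambda>n. n div 2) ^^ Suc x) s"
proof (induction x arbitrary: s)
  case 0
  show ?case by (simp, presburger)
next
  case (Suc x)
  have "((\<lambda>n. n div 2) ^^ x) (s div 2) = ((\<lambda>n. n div 2) ^^ x) s div 2"
    using funpow_swap1[of "\<lambda>n. n div 2" x s] by simp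
  then show ?case by (simp add: Suc)
qed

lemma decidable_mem_set_decode [computable_intros]:
  "computable f \<Longrightarrow> computable g \<Longrightarrow> decidable (\<lambda>x. f x \<in> set_decode (g x))"
  unfolding mem_set_decode_iff by (intro computable_intros computable_half)

lemma computable_power2 [computable_intros]: "computable f \<Longrightarrow> computable (\<lambda>x. 2 ^ f x)"
proof -
  assume "computable f"
  then have "computable (\<lambda>x. ((\<lambda>n. n + n) ^^ f x) 1)" by (intro computable_intros)
  moreover have "((\<lambda>n. n + n) ^^ k) 1 = (2::nat) ^ k" for k by (induction k) simp_all
  ultimately show ?thesis by simp
qed

text \<open>A member contributes a power of two to the code. Quantifiers over members of a coded set
  are thereby bounded by the code.\<close>

lemma mem_set_decode_less: "x \<in> set_decode s \<Longrightarrow> x < s"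
proof -
  assume "x \<in> set_decode s"
  then have "s div 2 ^ x \<noteq> 0" by (auto simp: set_decode_def intro: ccontr)
  then have "2 ^ x \<le> s" by (metis div_less not_le)
  then show ?thesis using less_exp[of x] by linarith
qed

section \<open>The halting predicate\<close>

lemma enc_inject: "enc f = enc g \<Longrightarrow> f = g"
proof (induction f arbitrary: g)
  case (Comp f fs)
  from Comp.prems obtain f' fs' where g: "g = Comp f' fs'" by (cases g) simp_all
  with Comp.prems have "enc f = enc f'" "map enc fs = map enc fs'" by (simp_all add: list_encode_eq)
  then show ?case using Comp.IH g by (metis list.inj_map_strong)
next
  case (Prim f1 f2) then show ?case by (cases g) auto
next
  case (Mu f) then show ?case by (cases g) auto
qed (case_tac g; simp)+

lemma prog_enc: "prog (enc f) = f"
  unfolding prog_def using enc_inject by auto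

text \<open>One unfolding of the recursion defining \<open>enc\<close>, with \<open>C\<close> in
  place of the codes of subprograms.\<close>

definition code_form :: "nat set \<Rightarrow> nat \<Rightarrow> bool" where
  "code_form C e \<longleftrightarrow>
     pfst e = 0 \<and> psnd e = 0 \<or>
     pfst e = 1 \<and> psnd e = 0 \<or>
     pfst e = 2 \<or>
     pfst e = 3 \<and> pfst (psnd e) \<in> C \<and>
       (\<forall>i<length (list_decode (psnd (psnd e))). lnth (psnd (psnd e)) i \<in> C) \<or>
     pfst e = 4 \<and> pfst (psnd e) \<in> C \<and> psnd (psnd e) \<in> C \<or>
     pfst e = 5 \<and> psnd e \<in> C"

lemma pfst_le: "pfst z \<le> z" and psnd_le: "psnd z \<le> z"
  using le_prod_encode_1[of "pfst z" "psnd z"] le_prod_encode_2[of "psnd z" "pfst z"] by simp_all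

text \<open>Strictness needs the nonzero first component: \<open>prod_encode (0, 1)\<close> is 1.
  The tags of compound programs are nonzero, so their parts have smaller codes.\<close>

lemma psnd_less: "pfst z \<noteq> 0 \<Longrightarrow> psnd z < z"
proof -
  assume "pfst z \<noteq> 0"
  obtain a b where z: "z = prod_encode (a, b)" using ex_prod_encode by blast
  have "n \<le> triangle n" for n by (induction n) auto
  from this[of "a + b"] \<open>pfst z \<noteq> 0\<close> show ?thesis by (simp add: z) (simp add: prod_encode_def)
qed

lemma ltl_le: "ltl l \<le> l" and lhd_le: "lhd l \<le> l"
  using psnd_le[of "l - 1"] pfst_le[of "l - 1"] by (simp_all add: lhd_def ltl_def)

lemma lnth_le: "lnth l i \<le> l"
proof -
  have "(ltl ^^ i) l \<le> l"
    by (induction i) (auto intro: order_trans[OF ltl_le])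
  then show ?thesis unfolding lnth_def using lhd_le order_trans by blast
qed

text \<open>Only the tags 3, 4 and 5 consult \<open>C\<close>, and only at parts of
  \<open>psnd e\<close>, which lie below \<open>e\<close>. This locality makes recursion over codes
  well founded.\<close>

lemma code_form_cong:
  assumes "\<And>c. c < e \<Longrightarrow> c \<in> C \<longleftrightarrow> c \<in> D"
  shows "code_form C e \<longleftrightarrow> code_form D e"
proof (cases "pfst e = 0")
  case False
  then have "c \<in> C \<longleftrightarrow> c \<in> D" if "c \<le> psnd e" for c
    using assms that psnd_less[of e] by simp
  then show ?thesis unfolding code_form_def
    using pfst_le psnd_le lnth_le order_trans by (smt (verit) order_refl)
qed (simp add: code_form_def)

lemma range_enc_iff: "e \<in> range enc \<longleftrightarrow> code_form (range enc) e"
proof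
  assume "e \<in> range enc"
  then obtain f where "e = enc f" by blast
  then show "code_form (range enc) e" by (cases f) (auto simp: code_form_def)
next
  assume *: "code_form (range enc) e"
  obtain t a where e: "e = prod_encode (t, a)" using ex_prod_encode by blast
  obtain b c where a: "a = prod_encode (b, c)" using ex_prod_encode by blast
  from * consider "e = enc Z" | "e = enc S" | i where "e = enc (Proj i)"
    | f where "t = 3" "b = enc f" "\<forall>i<length (list_decode c). lnth c i \<in> range enc"
    | f g where "e = enc (Prim f g)" | f where "e = enc (Mu f)"
    unfolding code_form_def by (auto simp: e a)
  then show "e \<in> range enc"
  proof cases
    case 4
    have "set (list_decode c) \<subseteq> range enc"
      using 4(3) by (auto simp: in_set_conv_nth lnth_eq)
    then obtain gs where "list_decode c = map enc gs" by (metis ex_map_conv subsetD rangeE)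
    then have "c = list_encode (map enc gs)" by (metis list_decode_inverse)
    then have "e = enc (Comp f gs)" using 4 by (simp add: e a)
    then show ?thesis by blast
  qed blast+
qed

text \<open>Course-of-values recursion: the bits of the least suitable \<open>s\<close> up to position \<open>e\<close>
  are the characteristic function of the set of codes.\<close>

lemma range_enc_decode:
  "e \<in> range enc \<longleftrightarrow>
    e \<in> set_decode (LEAST s. \<forall>c<Suc e. c \<in> set_decode s \<longleftrightarrow> code_form (set_decode s) c)"
  and ex_code_table: "\<exists>s. \<forall>c<Suc e. c \<in> set_decode s \<longleftrightarrow> code_form (set_decode s) c"
proof -
  let ?P = "\<lambda>s. \<forall>c<Suc e. c \<in> set_decode s \<longleftrightarrow> code_form (set_decode s) c"
  let ?s = "set_encode {c. c < Suc e \<and> c \<in> range enc}"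
  have dec: "set_decode ?s = {c. c < Suc e \<and> c \<in> range enc}"
    by (rule set_encode_inverse) simp
  have "?P ?s"
  proof (intro allI impI)
    fix c assume "c < Suc e"
    then show "c \<in> set_decode ?s \<longleftrightarrow> code_form (set_decode ?s) c"
      using code_form_cong[of c "range enc" "set_decode ?s"] range_enc_iff[of c] by (auto simp: dec)
  qed
  then show ex: "\<exists>s. ?P s" by blast
  \<comment> \<open>By locality, every table that passes the test up to \<open>e\<close> has the
    correct bits there, in particular the least one.\<close>
  have "c \<in> set_decode s \<longleftrightarrow> c \<in> range enc" if "?P s" "c < Suc e" for s c
    using that(2)
  proof (induction c rule: less_induct)
    case (less c)
    then show ?case
      using that(1) code_form_cong[of c "set_decode s" "range enc"] range_enc_iff[of c] by auto
  qed
  from this[OF LeastI_ex[OF ex], of e]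
  show "e \<in> range enc \<longleftrightarrow> e \<in> set_decode (LEAST s. ?P s)" by simp
qed

lemma decidable_code_form:
  assumes "computable s" "computable e"
  shows "decidable (\<lambda>x. code_form (set_decode (s x)) (e x))"
  unfolding code_form_def
  by (intro computable_intros assms computable_compose[OF assms(1)] computable_compose[OF assms(2)])

lemma decidable_range_enc [computable_intros]:
  "computable f \<Longrightarrow> decidable (\<lambda>x. f x \<in> range enc)"
proof -
  have "computable (\<lambda>e. LEAST s. \<forall>c<Suc e. c \<in> set_decode s \<longleftrightarrow> code_form (set_decode s) c)"
    by (rule computable_Least) (intro computable_intros decidable_code_form, rule ex_code_table)
  then have "decidable (\<lambda>e. e \<in> range enc)"
    unfolding range_enc_decode by (intro computable_intros)
  then show "computable f \<Longrightarrow> decidable (\<lambda>x. f x \<in> range enc)" by (rule decidable_compose)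
qed

text \<open>Stands for the claim that the program with code \<open>e\<close> returns
  \<open>y\<close> on the list with code \<open>l\<close>.\<close>

abbreviation fact_code :: "nat \<Rightarrow> nat \<Rightarrow> nat \<Rightarrow> nat" where
  "fact_code e l y \<equiv> prod_encode (e, prod_encode (l, y))"

text \<open>Every evaluation rule decreases the program, or keeps it and decreases the first argument.
  Hence a set of statements in which each one follows from the others by one rule contains only
  true statements, although no order of derivation is recorded.\<close>

definition justified :: "nat set \<Rightarrow> nat \<Rightarrow> nat \<Rightarrow> nat \<Rightarrow> bool" where
  "justified D e l y \<longleftrightarrow>
     pfst e = 0 \<and> y = 0 \<or>
     pfst e = 1 \<and> l \<noteq> 0 \<and> y = Suc (lhd l) \<or>
     pfst e = 2 \<and> psnd e < length (list_decode l) \<and> y = lnth l (psnd e) \<or>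
     pfst e = 3 \<and> (\<exists>ys. fact_code (pfst (psnd e)) ys y \<in> D \<and>
       length (list_decode ys) = length (list_decode (psnd (psnd e))) \<and>
       (\<forall>i<length (list_decode (psnd (psnd e))).
          fact_code (lnth (psnd (psnd e)) i) l (lnth ys i) \<in> D)) \<or>
     pfst e = 4 \<and> l \<noteq> 0 \<and> lhd l = 0 \<and> fact_code (pfst (psnd e)) (ltl l) y \<in> D \<or>
     pfst e = 4 \<and> l \<noteq> 0 \<and> lhd l \<noteq> 0 \<and>
       (\<exists>v. fact_code e (Suc (prod_encode (lhd l - 1, ltl l))) v \<in> D \<and>
            fact_code (psnd (psnd e)) (Suc (prod_encode (lhd l - 1, Suc (prod_encode (v, ltl l))))) y \<in> D) \<or>
     pfst e = 5 \<and> fact_code (psnd e) (Suc (prod_encode (y, l))) 0 \<in> D \<and>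
       (\<forall>m<y. \<exists>v. fact_code (psnd e) (Suc (prod_encode (m, l))) v \<in> D \<and> 0 < v)"

definition closed_facts :: "nat set \<Rightarrow> bool" where
  "closed_facts D \<longleftrightarrow> (\<forall>x\<in>D. justified D (pfst x) (pfst (psnd x)) (psnd (psnd x)))"

section \<open>Soundness and completeness of finite certificates\<close>

lemma justified_mono: "justified D e l y \<Longrightarrow> D \<subseteq> D' \<Longrightarrow> justified D' e l y"
  unfolding justified_def by (elim disjE) (simp | blast)+

lemma closed_facts_sound:
  assumes "closed_facts D"
  shows "fact_code (enc f) (list_encode xs) y \<in> D \<Longrightarrow> eval f xs y"
proof (induction f arbitrary: xs y)
  case Z
  with assms have "justified D (enc Z) (list_encode xs) y" unfolding closed_facts_def by fastforce
  then show ?case by (auto simp: justified_def intro: eval_Z)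
next
  case S
  with assms have "justified D (enc S) (list_encode xs) y" unfolding closed_facts_def by fastforce
  then show ?case by (cases xs) (auto simp: justified_def intro: eval_S)
next
  case (Proj i)
  with assms have "justified D (enc (Proj i)) (list_encode xs) y" unfolding closed_facts_def by fastforce
  then show ?case by (auto simp: justified_def intro: eval_Proj)
next
  case (Comp f gs)
  with assms have "justified D (enc (Comp f gs)) (list_encode xs) y" unfolding closed_facts_def by fastforce
  then obtain ys where ys: "fact_code (enc f) ys y \<in> D" "length (list_decode ys) = length gs"
    "\<And>i. i < length gs \<Longrightarrow> fact_code (enc (gs ! i)) (list_encode xs) (lnth ys i) \<in> D"
    by (auto simp: justified_def)
  have "eval f (list_decode ys) y" using Comp.IH(1) ys(1) by simp
  moreover have "list_all2 (\<lambda>g y. eval g xs y) gs (list_decode ys)"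
    using ys Comp.IH(2) by (auto simp: list_all2_conv_all_nth lnth_eq)
  ultimately show ?case by (metis eval_Comp)
next
  case (Prim g h)
  \<comment> \<open>A recursion step cites the same program again, so the induction on programs is
    supplemented by one on the recursion argument.\<close>
  have "eval (Prim g h) (n # as) y"
    if "fact_code (enc (Prim g h)) (list_encode (n # as)) y \<in> D" for n as y
    using that
  proof (induction n arbitrary: y)
    case 0
    with assms have "justified D (enc (Prim g h)) (list_encode (0 # as)) y"
      unfolding closed_facts_def by fastforce
    then have "fact_code (enc g) (list_encode as) y \<in> D" by (simp add: justified_def)
    then show ?case by (intro eval_Prim0 Prim.IH)
  next
    case (Suc n)
    from Suc.prems assms have "justified D (enc (Prim g h)) (list_encode (Suc n # as)) y"
      unfolding closed_facts_def by fastforce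
    then obtain v where "fact_code (enc (Prim g h)) (list_encode (n # as)) v \<in> D"
      "fact_code (enc h) (list_encode (n # v # as)) y \<in> D" by (auto simp: justified_def)
    then show ?case by (intro eval_PrimS[of g h n as v] Prim.IH Suc.IH)
  qed
  moreover have "xs \<noteq> []"
  proof -
    from Prim.prems assms have "justified D (enc (Prim g h)) (list_encode xs) y"
      unfolding closed_facts_def by fastforce
    then show ?thesis by (auto simp: justified_def)
  qed
  ultimately show ?case using Prim.prems by (cases xs) auto
next
  case (Mu f)
  with assms have "justified D (enc (Mu f)) (list_encode xs) y" unfolding closed_facts_def by fastforce
  then have *: "fact_code (enc f) (list_encode (y # xs)) 0 \<in> D"
    "\<forall>m<y. \<exists>v. fact_code (enc f) (list_encode (m # xs)) v \<in> D \<and> 0 < v"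
    by (auto simp: justified_def)
  show ?case
    by (rule eval_Mu) (use * Mu.IH in blast)+
qed

text \<open>Finiteness allows the certificate \<open>D\<close> to be coded by one number, which then
  serves as a halting stage.\<close>

definition derivable :: "nat \<Rightarrow> bool" where
  "derivable x \<longleftrightarrow> (\<exists>D. finite D \<and> closed_facts D \<and> x \<in> D)"

text \<open>The union of the certificates of the premises stays closed when the conclusion is added,
  because \<open>justified\<close> is monotone in the set.\<close>

lemma derivableI:
  assumes "finite A" and "\<And>x. x \<in> A \<Longrightarrow> derivable x" and "justified A e l y"
  shows "derivable (fact_code e l y)"
proof -
  from assms(2) obtain D where D: "\<And>x. x \<in> A \<Longrightarrow> finite (D x) \<and> closed_facts (D x) \<and> x \<in> D x"
    unfolding derivable_def by metis
  let ?D = "insert (fact_code e l y) (\<Union>x\<in>A. D x)"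
  have "justified ?D e l y" by (rule justified_mono[OF assms(3)]) (use D in blast)
  moreover have "justified ?D (pfst z) (pfst (psnd z)) (psnd (psnd z))" if "x \<in> A" "z \<in> D x" for x z
  proof (rule justified_mono)
    show "justified (D x) (pfst z) (pfst (psnd z)) (psnd (psnd z))"
      using D that unfolding closed_facts_def by blast
  qed (use that in blast)
  ultimately have "closed_facts ?D" unfolding closed_facts_def by auto
  moreover have "finite ?D" using assms(1) D by blast
  ultimately show ?thesis unfolding derivable_def by blast
qed

lemma eval_derivable: "eval f xs y \<Longrightarrow> derivable (fact_code (enc f) (list_encode xs) y)"
proof (induction rule: eval.induct)
  case (eval_Comp xs gs ys f z)
  let ?A = "insert (fact_code (enc f) (list_encode ys) z)
    ((\<lambda>i. fact_code (enc (gs ! i)) (list_encode xs) (ys ! i)) ` {..<length gs})"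
  have len: "length ys = length gs" using eval_Comp.IH(1) by (simp add: list_all2_lengthD)
  show ?case
  proof (rule derivableI[of ?A])
    show "derivable x" if "x \<in> ?A" for x
      using that eval_Comp.IH by (auto simp: list_all2_conv_all_nth)
    show "justified ?A (enc (Comp f gs)) (list_encode xs) z"
      unfolding justified_def
      by (intro disjI2 disjI1[of "_ \<and> _"]) (auto simp: len intro!: exI[of _ "list_encode ys"])
  qed simp
next
  case (eval_Prim0 g xs y h)
  then show ?case
    by (intro derivableI[of "{fact_code (enc g) (list_encode xs) y}"]) (auto simp: justified_def)
next
  case (eval_PrimS g h n xs y z)
  then show ?case
    by (intro derivableI[of "{fact_code (enc (Prim g h)) (list_encode (n # xs)) y,
          fact_code (enc h) (list_encode (n # y # xs)) z}"]) (auto simp: justified_def)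
next
  case (eval_Mu f n xs)
  from eval_Mu.IH(2) obtain v where
    v: "\<And>m. m < n \<Longrightarrow> 0 < v m \<and> derivable (fact_code (enc f) (list_encode (m # xs)) (v m))"
    by metis
  let ?A = "insert (fact_code (enc f) (list_encode (n # xs)) 0)
    ((\<lambda>m. fact_code (enc f) (list_encode (m # xs)) (v m)) ` {..<n})"
  show ?case
  proof (rule derivableI[of ?A])
    show "derivable x" if "x \<in> ?A" for x using that v eval_Mu.IH(1) by auto
    show "justified ?A (enc (Mu f)) (list_encode xs) n"
      using v by (auto simp: justified_def)
  qed simp
qed (rule derivableI[of "{}"]; simp add: justified_def)+

text \<open>The stage \<open>s\<close> is itself the code of a certificate, so stages are not
  cumulative. For a number that is no program code, \<open>prog\<close> defaults to
  \<open>Z\<close>, which always halts; hence the implication.\<close>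

definition halts_at :: "nat \<Rightarrow> nat \<Rightarrow> nat \<Rightarrow> bool" where
  "halts_at e x s \<longleftrightarrow> (e \<in> range enc \<longrightarrow> closed_facts (set_decode s) \<and>
     (\<exists>v<s. fact_code e (list_encode [x]) v \<in> set_decode s))"

text \<open>Pairing dominates its components. This bounds the existential quantifiers in
  \<open>justified\<close> and \<open>halts_at\<close> by the code of the set.\<close>

lemma fact_code_less:
  assumes "fact_code e l y \<in> set_decode s" shows "l < s" "y < s"
proof -
  have "prod_encode (l, y) < s"
    using mem_set_decode_less[OF assms] le_prod_encode_2[of "prod_encode (l, y)" e] by simp
  then show "l < s" "y < s"
    using le_prod_encode_1[of l y] le_prod_encode_2[of y l] by simp_all
qed

lemma mem_W_iff: "x \<in> W e \<longleftrightarrow> (\<exists>s. halts_at e x s)"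
proof (cases "e \<in> range enc")
  case True
  then obtain f where e: "e = enc f" by blast
  have "(\<exists>s. halts_at e x s) \<longleftrightarrow> (\<exists>v. eval f [x] v)"
  proof
    assume "\<exists>s. halts_at e x s"
    then show "\<exists>v. eval f [x] v"
      unfolding halts_at_def using True closed_facts_sound[of _ f "[x]"] e by meson
  next
    assume "\<exists>v. eval f [x] v"
    then obtain v D where D: "finite D" "closed_facts D" "fact_code e (list_encode [x]) v \<in> D"
      using eval_derivable unfolding derivable_def e by blast
    then have "set_decode (set_encode D) = D" by simp
    then have "halts_at e x (set_encode D)"
      unfolding halts_at_def using D fact_code_less(2) by metis
    then show "\<exists>s. halts_at e x s" ..
  qed
  then show ?thesis by (simp add: W_def e prog_enc)
next
  case False
  then have "prog e = Z" unfolding prog_def by auto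
  then show ?thesis using False eval_Z by (auto simp: W_def halts_at_def)
qed

lemma decidable_justified [computable_intros]:
  assumes "computable s" "computable e" "computable l" "computable y"
  shows "decidable (\<lambda>x. justified (set_decode (s x)) (e x) (l x) (y x))"
proof -
  have ex_iff:
    "(\<exists>v. fact_code a b v \<in> set_decode s \<and> Q v) \<longleftrightarrow> (\<exists>v<s. fact_code a b v \<in> set_decode s \<and> Q v)"
    "(\<exists>v. fact_code a v b \<in> set_decode s \<and> Q v) \<longleftrightarrow> (\<exists>v<s. fact_code a v b \<in> set_decode s \<and> Q v)"
    for a b s Q
    using fact_code_less by blast+
  show ?thesis unfolding justified_def ex_iff
    by (intro computable_intros assms assms[THEN computable_compose])
qed

lemma decidable_halts_at [computable_intros]:
  assumes "computable e" "computable f" "computable s"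
  shows "decidable (\<lambda>x. halts_at (e x) (f x) (s x))"
proof -
  have "closed_facts (set_decode s) \<longleftrightarrow>
      (\<forall>x<s. x \<in> set_decode s \<longrightarrow> justified (set_decode s) (pfst x) (pfst (psnd x)) (psnd (psnd x)))" for s
    unfolding closed_facts_def using mem_set_decode_less by blast
  then show ?thesis unfolding halts_at_def list_encode.simps
    by (simp only:) (intro computable_intros assms assms[THEN computable_compose])
qed

section \<open>Uniform indices of c.e. sets\<close>

lemma computable_enc_const_prog: "computable (\<lambda>c. enc (const_prog c))"
proof -
  have "enc (const_prog c) =
    ((\<lambda>v. prod_encode (3, prod_encode (enc S, Suc (prod_encode (v, 0))))) ^^ c) (enc Z)" for c
    by (induction c) simp_all
  then show ?thesis by (simp only:) (intro computable_intros)
qed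

text \<open>An s-m-n argument: the parameter \<open>c\<close> is hard-wired as a constant program,
  and the program for \<open>c\<close> pairs its input with \<open>c\<close> and searches for
  \<open>u\<close>.\<close>

lemma uniform_index:
  assumes "decidable (\<lambda>z. Q (pfst z) (psnd z))"
  obtains h where "computable h" "\<And>c x. x \<in> W (h c) \<longleftrightarrow> (\<exists>u. Q u (prod_encode (x, c)))"
proof -
  obtain p where p: "\<And>u w. eval p [u, w] (if Q u w then 0 else 1)"
    using computable2_pair[OF assms[unfolded decidable_def]] unfolding computable2_def by blast
  obtain q where q: "\<And>x y. eval q [x, y] (prod_encode (x, y))"
    using computable2_prod_encode unfolding computable2_def by blast
  have Mu: "(\<exists>n. eval (Mu p) [w] n) \<longleftrightarrow> (\<exists>u. Q u w)" for w
  proof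
    assume "\<exists>n. eval (Mu p) [w] n"
    then obtain n where "eval p [n, w] 0" by (auto elim: eval_MuE)
    from eval_functional[OF this p] show "\<exists>u. Q u w" by (metis zero_neq_one)
  next
    assume ex: "\<exists>u. Q u w"
    have "eval (Mu p) [w] (LEAST u. Q u w)"
    proof (rule eval_Mu)
      show "eval p [LEAST u. Q u w, w] 0" using p[of "LEAST u. Q u w" w] LeastI_ex[OF ex] by simp
      show "\<forall>m<LEAST u. Q u w. \<exists>y. 0 < y \<and> eval p [m, w] y"
        using p not_less_Least by (metis zero_less_one)
    qed
    then show "\<exists>n. eval (Mu p) [w] n" ..
  qed
  define r where "r c = Comp (Mu p) [Comp q [Proj 0, const_prog c]]" for c
  show thesis
  proof
    \<comment> \<open>Spelled out, the code depends on \<open>c\<close> only through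
      \<open>enc (const_prog c)\<close>.\<close>
    have "enc (r c) = prod_encode (3, prod_encode (enc (Mu p), Suc (prod_encode (
      prod_encode (3, prod_encode (enc q, Suc (prod_encode (enc (Proj 0), Suc (prod_encode (enc (const_prog c), 0)))))), 0))))" for c
      by (simp add: r_def)
    then show "computable (\<lambda>c. enc (r c))"
      by (simp only:) (intro computable_intros computable_enc_const_prog)
    show "x \<in> W (enc (r c)) \<longleftrightarrow> (\<exists>u. Q u (prod_encode (x, c)))" for c x
    proof -
      have arg: "eval (Comp q [Proj 0, const_prog c]) [x] (prod_encode (x, c))"
        by (rule eval_Comp2[OF eval_Proj_0 eval_const_prog q])
      have "eval (r c) [x] n \<longleftrightarrow> eval (Mu p) [prod_encode (x, c)] n" for n
      proof
        assume "eval (r c) [x] n"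
        then obtain v where "eval (Comp q [Proj 0, const_prog c]) [x] v" "eval (Mu p) [v] n"
          unfolding r_def by (auto elim!: eval_CompE[of "Mu p"] simp: list_all2_Cons1)
        then show "eval (Mu p) [prod_encode (x, c)] n" using eval_functional[OF arg] by blast
      qed (simp add: r_def eval_Comp1[OF arg])
      then have "eval (r c) [x] = eval (Mu p) [prod_encode (x, c)]" by blast
      then show ?thesis by (simp add: W_def prog_enc Mu)
    qed
  qed
qed

section \<open>Equality of columns as infinitary behaviour of a decidable predicate\<close>

text \<open>Serves to choose one stage, one bound on events or one \<open>k\<close> for finitely
  many requirements at once.\<close>

lemma finite_uniform_bound:
  fixes P :: "'a \<Rightarrow> nat \<Rightarrow> bool"
  assumes "finite A" and "\<And>x. x \<in> A \<Longrightarrow> \<exists>v. P x v"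
    and mono: "\<And>x v v'. P x v \<Longrightarrow> v \<le> v' \<Longrightarrow> P x v'"
  shows "\<exists>v. \<forall>x\<in>A. P x v"
  using assms(1,2)
proof (induction A rule: finite_induct)
  case (insert a A)
  then obtain v where "\<forall>x\<in>A. P x v" by auto
  moreover obtain v' where "P a v'" using insert.prems by auto
  ultimately have "\<forall>x\<in>insert a A. P x (max v v')" using mono by (metis insert_iff max.cobounded1 max.cobounded2)
  then show ?case ..
qed simp

definition event :: "nat \<Rightarrow> nat \<Rightarrow> nat \<Rightarrow> nat \<Rightarrow> nat" where
  "event a b m p = prod_encode (prod_encode (a, b), prod_encode (m, p))"

definition true_events :: "nat set" where
  "true_events = {e. column (W (pfst (pfst e))) (pfst (psnd e)) = column (W (psnd (pfst e))) (psnd (psnd e))}"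

text \<open>A bounded approximation to equality of the two columns: for a true event every
  \<open>L\<close> is attained with some \<open>v\<close>, for a false one only finitely many
  \<open>L\<close> are. As stages are not cumulative, \<open>w\<close> ranges over all stages below
  \<open>v\<close>.\<close>

definition agree :: "nat \<Rightarrow> nat \<Rightarrow> nat \<Rightarrow> bool" where
  "agree e L v \<longleftrightarrow> (\<forall>y<L. \<forall>u<L.
     (halts_at (pfst (pfst e)) (prod_encode (y, pfst (psnd e))) u \<longrightarrow>
       (\<exists>w<v. halts_at (psnd (pfst e)) (prod_encode (y, psnd (psnd e))) w)) \<and>
     (halts_at (psnd (pfst e)) (prod_encode (y, psnd (psnd e))) u \<longrightarrow>
       (\<exists>w<v. halts_at (pfst (pfst e)) (prod_encode (y, pfst (psnd e))) w)))"

text \<open>Stages are pairs \<open>(L, v)\<close>, and an event fires at most once for each length of agreement \<open>L\<close>.\<close>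

definition fires :: "nat \<Rightarrow> nat \<Rightarrow> bool" where
  "fires e s \<longleftrightarrow> agree e (pfst s) (psnd s) \<and> (\<forall>v<psnd s. \<not> agree e (pfst s) v)"

lemma decidable_agree [computable_intros]:
  assumes "computable e" "computable l" "computable v"
  shows "decidable (\<lambda>x. agree (e x) (l x) (v x))"
  unfolding agree_def by (intro computable_intros assms assms[THEN computable_compose])

lemma decidable_fires [computable_intros]:
  assumes "computable e" "computable s"
  shows "decidable (\<lambda>x. fires (e x) (s x))"
  unfolding fires_def by (intro computable_intros assms assms[THEN computable_compose])

lemma mem_column_iff: "y \<in> column (W e) m \<longleftrightarrow> (\<exists>u. halts_at e (prod_encode (y, m)) u)"
  by (simp add: column_def mem_W_iff)

lemma ex_agree: "e \<in> true_events \<Longrightarrow> \<exists>v. agree e L v"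
proof -
  assume "e \<in> true_events"
  then have eq: "(\<exists>u. halts_at (pfst (pfst e)) (prod_encode (y, pfst (psnd e))) u) \<longleftrightarrow>
      (\<exists>u. halts_at (psnd (pfst e)) (prod_encode (y, psnd (psnd e))) u)" for y
    unfolding true_events_def mem_Collect_eq mem_column_iff[symmetric] by simp
  \<comment> \<open>Each \<open>y\<close> lies in both columns or in neither, so one threshold
    \<open>v\<close> serves both clauses of \<open>agree\<close>.\<close>
  define P where "P y v \<longleftrightarrow> ((\<exists>u. halts_at (pfst (pfst e)) (prod_encode (y, pfst (psnd e))) u) \<longrightarrow>
      (\<exists>w<v. halts_at (psnd (pfst e)) (prod_encode (y, psnd (psnd e))) w) \<and>
      (\<exists>w<v. halts_at (pfst (pfst e)) (prod_encode (y, pfst (psnd e))) w))" for y v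
  have "\<exists>v. \<forall>y\<in>{..<L}. P y v"
  proof (rule finite_uniform_bound)
    show "\<exists>v. P y v" for y
    proof (cases "\<exists>u. halts_at (pfst (pfst e)) (prod_encode (y, pfst (psnd e))) u")
      case True
      then obtain u u' where "halts_at (pfst (pfst e)) (prod_encode (y, pfst (psnd e))) u"
        "halts_at (psnd (pfst e)) (prod_encode (y, psnd (psnd e))) u'" using eq by blast
      moreover have "u < Suc (max u u')" "u' < Suc (max u u')" by auto
      ultimately show ?thesis unfolding P_def by blast
    qed (simp add: P_def)
    show "P y v'" if "P y v" "v \<le> v'" for y v v'
      using that unfolding P_def by (meson order_less_le_trans)
  qed simp
  then obtain v where "\<forall>y\<in>{..<L}. P y v" ..
  then have "agree e L v" unfolding agree_def P_def using eq by blast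
  then show ?thesis ..
qed

text \<open>A true event fires once for each \<open>L\<close>, at the least suitable
  \<open>v\<close>. Conversely each \<open>L\<close> accounts for at most one stage, so infinitely
  many firings give agreement at arbitrarily large \<open>L\<close>.\<close>

lemma true_events_iff: "e \<in> true_events \<longleftrightarrow> infinite {s. fires e s}"
proof
  assume e: "e \<in> true_events"
  have "L \<in> pfst ` {s. fires e s}" for L
  proof -
    have "fires e (prod_encode (L, LEAST v. agree e L v))"
      unfolding fires_def using LeastI_ex[OF ex_agree[OF e]] not_less_Least by auto
    then show ?thesis by force
  qed
  then have "pfst ` {s. fires e s} = UNIV" by blast
  then show "infinite {s. fires e s}" by (metis finite_imageI infinite_UNIV_nat)
next
  assume inf: "infinite {s. fires e s}"
  have "inj_on pfst {s. fires e s}"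
  proof (rule inj_onI)
    fix s s' assume "s \<in> {s. fires e s}" "s' \<in> {s. fires e s}" and p: "pfst s = pfst s'"
    then have "\<not> psnd s < psnd s'" "\<not> psnd s' < psnd s" unfolding fires_def by auto
    then have "psnd s = psnd s'" by simp
    with p show "s = s'" by (metis prod_encode_pfst_psnd)
  qed
  with inf have "infinite (pfst ` {s. fires e s})" by (simp add: finite_image_iff)
  then have large: "\<exists>L>N. \<exists>v. agree e L v" for N
    unfolding infinite_nat_iff_unbounded fires_def by blast
  have "(\<exists>u. halts_at (pfst (pfst e)) (prod_encode (y, pfst (psnd e))) u) \<longleftrightarrow>
      (\<exists>u. halts_at (psnd (pfst e)) (prod_encode (y, psnd (psnd e))) u)" for y
  proof -
    \<comment> \<open>\<open>L\<close> is taken above both the element and the stage at which it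
      appears, so \<open>agree\<close> must find it in the other column.\<close>
    have "\<exists>L v. y < L \<and> u < L \<and> agree e L v" for u
      using large[of "max y u"] by (metis max_less_iff_conj)
    then show ?thesis unfolding agree_def by meson
  qed
  then show "e \<in> true_events" unfolding true_events_def by (auto simp: mem_column_iff)
qed

lemma event_true_iff: "event a b m p \<in> true_events \<longleftrightarrow> column (W a) m = column (W b) p"
  by (simp add: event_def true_events_def)

text \<open>\<open>T\<close> is either the set of true events or a finite guess at it. The condition
  gets stronger as \<open>k\<close> grows.\<close>

definition matched :: "nat \<Rightarrow> nat set \<Rightarrow> nat \<Rightarrow> nat \<Rightarrow> bool" where
  "matched k T a b \<longleftrightarrow> (\<forall>m<Suc k. (\<exists>p. event a b m p \<in> T) \<and> (\<exists>p. event b a m p \<in> T))"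

lemma matched_sym: "matched k T a b \<Longrightarrow> matched k T b a"
  unfolding matched_def by blast

lemma matched_mono: "matched k T a b \<Longrightarrow> T \<subseteq> T' \<Longrightarrow> matched k T' a b"
  unfolding matched_def by blast

lemma E_set_ce_iff: "E_set_ce a b \<longleftrightarrow> (\<forall>k. matched k true_events a b)"
proof -
  have "(\<forall>k. matched k true_events a b) \<longleftrightarrow>
      (\<forall>m. column (W a) m \<in> range (column (W b)) \<and> column (W b) m \<in> range (column (W a)))"
    unfolding matched_def event_true_iff image_iff by (metis lessI UNIV_I)
  then show ?thesis unfolding E_set_ce_def by blast
qed

section \<open>The c.e. sets of the reduction\<close>

text \<open>Reachability from \<open>i\<close> to \<open>q\<close>, phrased with a bounded quantifier over sets closed under the
  edges, so that it is visibly decidable.\<close>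

definition connected :: "nat \<Rightarrow> nat \<Rightarrow> nat set \<Rightarrow> nat \<Rightarrow> nat \<Rightarrow> bool" where
  "connected X k T i q \<longleftrightarrow> (\<forall>s<2 ^ length (list_decode X). i \<in> set_decode s \<longrightarrow>
     (\<forall>a<length (list_decode X). \<forall>b<length (list_decode X).
        a \<in> set_decode s \<and> matched k T (lnth X a) (lnth X b) \<longrightarrow> b \<in> set_decode s) \<longrightarrow>
     q \<in> set_decode s)"

definition alarm :: "nat \<Rightarrow> nat \<Rightarrow> nat \<Rightarrow> bool" where
  "alarm r F t \<longleftrightarrow> (\<exists>e<Suc r. e \<notin> set_decode F \<and> fires e t)"

text \<open>Requiring \<open>t\<close> to be exactly the last alarm (\<open>0\<close> if there is none) leaves at most one
  surviving \<open>t\<close> for each \<open>(r, F)\<close>.\<close>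

abbreviation guess :: "nat \<Rightarrow> nat \<Rightarrow> nat \<Rightarrow> nat \<Rightarrow> nat" where
  "guess r F t q \<equiv> prod_encode (prod_encode (r, F), prod_encode (t, q))"

text \<open>The first two clauses leave finitely many \<open>F\<close> and \<open>q\<close> for each
  \<open>r\<close>; the last two test \<open>t\<close>. A surviving \<open>F\<close> contains all
  true events up to \<open>r\<close>, but possibly false ones too.\<close>

definition refuted :: "nat \<Rightarrow> nat \<Rightarrow> nat \<Rightarrow> nat \<Rightarrow> nat \<Rightarrow> nat \<Rightarrow> bool" where
  "refuted X r F t q u \<longleftrightarrow> 2 ^ Suc r \<le> F \<or> length (list_decode X) \<le> q \<or>
     (t \<noteq> 0 \<and> \<not> alarm r F t) \<or> (t < u \<and> alarm r F u)"

lemma decidable_matched [computable_intros]: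
  assumes "computable k" "computable s" "computable a" "computable b"
  shows "decidable (\<lambda>x. matched (k x) (set_decode (s x)) (a x) (b x))"
proof -
  \<comment> \<open>An event has the shape \<open>fact_code (prod_encode (a, b)) m p\<close>, so the
    bound on the last component applies.\<close>
  have "p < s" if "event a b m p \<in> set_decode s" for a b m p s
    using that fact_code_less(2) unfolding event_def by blast
  then have "(\<exists>p. event a b m p \<in> set_decode s) \<longleftrightarrow> (\<exists>p<s. event a b m p \<in> set_decode s)" for a b m s
    by blast
  then show ?thesis unfolding matched_def
    by (simp only:) (unfold event_def, intro computable_intros assms assms[THEN computable_compose])
qed

lemma decidable_connected [computable_intros]:
  assumes "computable X" "computable k" "computable s" "computable i" "computable q"
  shows "decidable (\<lambda>x. connected (X x) (k x) (set_decode (s x)) (i x) (q x))"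
  unfolding connected_def by (intro computable_intros assms assms[THEN computable_compose])

lemma decidable_refuted [computable_intros]:
  assumes "computable X" "computable r" "computable F" "computable t" "computable q" "computable u"
  shows "decidable (\<lambda>x. refuted (X x) (r x) (F x) (t x) (q x) (u x))"
  unfolding refuted_def alarm_def by (intro computable_intros assms assms[THEN computable_compose])

text \<open>Refutation asks for a witness \<open>u\<close> of a decidable condition, and
  connectivity is decidable, so these sets are uniformly c.e. The parameter \<open>X\<close> codes
  the whole input list, since paths may pass through any entry.\<close>

lemma obtain_reduction_index:
  obtains h where "computable h"
    "\<And>X i k r F t q. guess r F t q \<in> column (W (h (prod_encode (X, i)))) k \<longleftrightarrow>
       (\<exists>u. refuted X r F t q u) \<or> connected X k (set_decode F) i q"
proof -
  \<comment> \<open>The projections unpack \<open>w\<close> as the pair of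
    \<open>(guess r F t q, k)\<close> and \<open>(X, i)\<close>.\<close>
  define Q where "Q u w \<longleftrightarrow>
    refuted (pfst (psnd w)) (pfst (pfst (pfst (pfst w)))) (psnd (pfst (pfst (pfst w))))
      (pfst (psnd (pfst (pfst w)))) (psnd (psnd (pfst (pfst w)))) u \<or>
    connected (pfst (psnd w)) (psnd (pfst w)) (set_decode (psnd (pfst (pfst (pfst w)))))
      (psnd (psnd w)) (psnd (psnd (pfst (pfst w))))" for u w
  have "decidable (\<lambda>z. Q (pfst z) (psnd z))"
    unfolding Q_def by (intro computable_intros)
  then obtain h where h: "computable h" "\<And>c x. x \<in> W (h c) \<longleftrightarrow> (\<exists>u. Q u (prod_encode (x, c)))"
    by (rule uniform_index) blast
  show thesis
    by (rule that[OF h(1)]) (simp add: column_def h(2) Q_def)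
qed

section \<open>Paths and surviving guesses\<close>

lemma connected_refl: "connected X k T i i"
  unfolding connected_def by blast

lemma connected_step:
  assumes "i < length (list_decode X)" "j < length (list_decode X)"
    and "matched k T (lnth X i) (lnth X j)" and "connected X k T j q"
  shows "connected X k T i q"
  using assms unfolding connected_def by blast

lemma set_encode_less:
  assumes "A \<subseteq> {..<n}" shows "set_encode A < 2 ^ n"
proof -
  have "set_encode A \<le> (\<Sum>i\<in>{0..<n}. 2 ^ i)"
    unfolding set_encode_def using assms by (intro sum_mono2) auto
  also have "\<dots> < 2 ^ n" by (simp add: sum_power2)
  finally show ?thesis .
qed

text \<open>The positions satisfying \<open>P\<close> form a closed set whose code is below the
  bound in \<open>connected\<close>, so it is among the sets quantified over there.\<close>

lemma connected_invariant:
  assumes "connected X k T i q" and "i < length (list_decode X)" and "P i"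
    and "\<And>a b. a < length (list_decode X) \<Longrightarrow> b < length (list_decode X) \<Longrightarrow> P a \<Longrightarrow>
      matched k T (lnth X a) (lnth X b) \<Longrightarrow> P b"
  shows "P q"
proof -
  let ?A = "{a. a < length (list_decode X) \<and> P a}"
  have "set_encode ?A < 2 ^ length (list_decode X)" by (rule set_encode_less) auto
  moreover have "set_decode (set_encode ?A) = ?A" by (rule set_encode_inverse) simp
  ultimately have "q \<in> ?A"
    using assms unfolding connected_def by (metis (no_types, lifting) mem_Collect_eq)
  then show ?thesis by simp
qed

text \<open>A true event outside \<open>F\<close> fires at infinitely many stages, hence raises an
  alarm after \<open>t\<close>.\<close>

lemma unrefuted_contains_true:
  assumes "\<And>u. \<not> refuted X r F t q u" and "e \<in> true_events" and "e \<le> r"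
  shows "e \<in> set_decode F"
proof (rule ccontr)
  assume "e \<notin> set_decode F"
  obtain u where "t < u" "fires e u"
    using assms(2) unfolding true_events_iff infinite_nat_iff_unbounded by blast
  then have "refuted X r F t q u"
    using assms(3) \<open>e \<notin> set_decode F\<close> unfolding refuted_def alarm_def by (auto simp: less_Suc_eq_le)
  with assms(1) show False by blast
qed

text \<open>The larger of two distinct stages is nonzero, hence an alarm, and so refutes the smaller
  one.\<close>

lemma unrefuted_stage_unique:
  assumes "\<And>u. \<not> refuted X r F t q u" and "\<And>u. \<not> refuted X r F t' q u"
  shows "t = t'"
  using assms unfolding refuted_def by (metis linorder_neqE_nat not_less_zero)

text \<open>Outside the correct \<open>F\<close> there are finitely many events up to
  \<open>r\<close>, each firing finitely often, so a last alarm exists unless there is none at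
  all.\<close>

lemma ex_unrefuted:
  assumes "q < length (list_decode X)"
  shows "\<exists>t. \<forall>u. \<not> refuted X r (set_encode {e. e \<le> r \<and> e \<in> true_events}) t q u"
proof -
  let ?T = "{e. e \<le> r \<and> e \<in> true_events}"
  let ?F = "set_encode ?T"
  have dec: "set_decode ?F = ?T" by (rule set_encode_inverse) simp
  have less: "?F < 2 ^ Suc r" by (rule set_encode_less) auto
  let ?U = "{u. alarm r ?F u}"
  have "?U = (\<Union>e\<in>{e. e \<le> r \<and> e \<notin> true_events}. {u. fires e u})"
    unfolding alarm_def dec by (auto simp: less_Suc_eq_le)
  then have fin: "finite ?U" by (auto simp: true_events_iff)
  show ?thesis
  proof (cases "?U = {}")
    case True
    then have "\<forall>u. \<not> refuted X r ?F 0 q u"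
      using less assms unfolding refuted_def by auto
    then show ?thesis ..
  next
    case False
    have "\<not> refuted X r ?F (Max ?U) q u" for u
      using less assms Max_in[OF fin False] Max_ge[OF fin, of u] unfolding refuted_def by auto
    then show ?thesis by blast
  qed
qed

text \<open>Let \<open>e0\<close> bound true events that match the columns up to \<open>k\<close>.
  For \<open>r\<close> at least \<open>e0\<close>, every surviving \<open>F\<close> contains them
  and joins \<open>i\<close> and \<open>j\<close> directly. For smaller \<open>r\<close>, finitely
  many \<open>F\<close> and \<open>q\<close> survive, with one \<open>t\<close> each.\<close>

lemma finite_disagreement:
  assumes ij: "i < length (list_decode X)" "j < length (list_decode X)"
    and E: "E_set_ce (lnth X i) (lnth X j)"
  shows "finite {guess r F t q | r F t q. (\<forall>u. \<not> refuted X r F t q u) \<and>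
    \<not> (connected X k (set_decode F) i q \<longleftrightarrow> connected X k (set_decode F) j q)}" (is "finite ?D")
proof -
  have "\<exists>e0. \<forall>m\<in>{..<Suc k}. (\<exists>p. event (lnth X i) (lnth X j) m p \<in> {e. e \<le> e0 \<and> e \<in> true_events}) \<and>
      (\<exists>p. event (lnth X j) (lnth X i) m p \<in> {e. e \<le> e0 \<and> e \<in> true_events})"
  proof (rule finite_uniform_bound)
    fix m assume "m \<in> {..<Suc k}"
    with E obtain p p' where "event (lnth X i) (lnth X j) m p \<in> true_events"
      "event (lnth X j) (lnth X i) m p' \<in> true_events"
      unfolding E_set_ce_iff matched_def by blast
    then show "\<exists>v. (\<exists>p. event (lnth X i) (lnth X j) m p \<in> {e. e \<le> v \<and> e \<in> true_events}) \<and>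
      (\<exists>p. event (lnth X j) (lnth X i) m p \<in> {e. e \<le> v \<and> e \<in> true_events})"
      by (metis (no_types, lifting) max.cobounded1 max.cobounded2 mem_Collect_eq)
  next
    fix m v v' :: nat
    assume *: "(\<exists>p. event (lnth X i) (lnth X j) m p \<in> {e. e \<le> v \<and> e \<in> true_events}) \<and>
      (\<exists>p. event (lnth X j) (lnth X i) m p \<in> {e. e \<le> v \<and> e \<in> true_events})" "v \<le> v'"
    then have "{e. e \<le> v \<and> e \<in> true_events} \<subseteq> {e. e \<le> v' \<and> e \<in> true_events}" by auto
    with * show "(\<exists>p. event (lnth X i) (lnth X j) m p \<in> {e. e \<le> v' \<and> e \<in> true_events}) \<and>
      (\<exists>p. event (lnth X j) (lnth X i) m p \<in> {e. e \<le> v' \<and> e \<in> true_events})" by blast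
  qed simp
  then obtain e0 where e0: "matched k {e. e \<le> e0 \<and> e \<in> true_events} (lnth X i) (lnth X j)"
    unfolding matched_def by blast
  have small: "r < e0 \<and> F < 2 ^ Suc e0 \<and> q < length (list_decode X)"
    if unref: "\<And>u. \<not> refuted X r F t q u"
      and differ: "\<not> (connected X k (set_decode F) i q \<longleftrightarrow> connected X k (set_decode F) j q)" for r F t q
  proof -
    have "r < e0"
    proof (rule ccontr)
      assume "\<not> r < e0"
      then have "{e. e \<le> e0 \<and> e \<in> true_events} \<subseteq> set_decode F"
        using unrefuted_contains_true[OF unref] by auto
      then have "matched k (set_decode F) (lnth X i) (lnth X j)" by (rule matched_mono[OF e0])
      with differ ij show False using connected_step matched_sym by metis
    qed
    moreover have "F < 2 ^ Suc r" "q < length (list_decode X)"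
      using unref[of 0] unfolding refuted_def by auto
    moreover have "(2::nat) ^ Suc r \<le> 2 ^ Suc e0"
      using \<open>r < e0\<close> by (intro power_increasing) auto
    ultimately show ?thesis by linarith
  qed
  \<comment> \<open>The key omits \<open>t\<close>, which the other components of a surviving guess
    determine.\<close>
  let ?key = "\<lambda>z. (pfst (pfst z), psnd (pfst z), psnd (psnd z))"
  have "inj_on ?key ?D"
  proof (rule inj_onI)
    fix x y assume "x \<in> ?D" "y \<in> ?D" and key: "?key x = ?key y"
    then obtain r F t q t' where "x = guess r F t q" "y = guess r F t' q"
      "\<forall>u. \<not> refuted X r F t q u" "\<forall>u. \<not> refuted X r F t' q u" by auto
    then show "x = y" using unrefuted_stage_unique by blast
  qed
  moreover have "?key ` ?D \<subseteq> {..<e0} \<times> {..<2 ^ Suc e0} \<times> {..<length (list_decode X)}"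
    using small by fastforce
  then have "finite (?key ` ?D)" by (rule finite_subset) simp
  ultimately show ?thesis by (rule finite_imageD[rotated])
qed

text \<open>For suitable \<open>k\<close>, true events join only equivalent entries, so no path
  leaves a class of \<open>E_set_ce\<close>. With \<open>F r\<close> exactly the true events up to
  \<open>r\<close> and \<open>q = i\<close>, each \<open>r\<close> yields a guess connected with
  \<open>i\<close> but not with \<open>j\<close>.\<close>

lemma infinite_disagreement:
  assumes ij: "i < length (list_decode X)" "j < length (list_decode X)"
    and E: "\<not> E_set_ce (lnth X i) (lnth X j)"
  shows "\<exists>k. infinite {guess r F t q | r F t q. (\<forall>u. \<not> refuted X r F t q u) \<and>
    connected X k (set_decode F) i q \<and> \<not> connected X k (set_decode F) j q}"
proof -
  let ?n = "length (list_decode X)"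
  \<comment> \<open>A failure of matching persists for larger \<open>k\<close>, so a single
    \<open>k\<close> separates all inequivalent pairs of the list.\<close>
  have "\<exists>k. \<forall>x\<in>{..<?n} \<times> {..<?n}. E_set_ce (lnth X (fst x)) (lnth X (snd x)) \<or>
      \<not> matched k true_events (lnth X (fst x)) (lnth X (snd x))"
  proof (rule finite_uniform_bound)
    fix x :: "nat \<times> nat" and v v' :: nat
    assume "E_set_ce (lnth X (fst x)) (lnth X (snd x)) \<or>
        \<not> matched v true_events (lnth X (fst x)) (lnth X (snd x))" "v \<le> v'"
    then show "E_set_ce (lnth X (fst x)) (lnth X (snd x)) \<or>
        \<not> matched v' true_events (lnth X (fst x)) (lnth X (snd x))"
      unfolding matched_def by (meson Suc_le_mono less_le_trans)
  qed (use E_set_ce_iff in blast)+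
  then obtain k where k: "\<And>a b. a < ?n \<Longrightarrow> b < ?n \<Longrightarrow>
      matched k true_events (lnth X a) (lnth X b) \<Longrightarrow> E_set_ce (lnth X a) (lnth X b)"
    by fastforce
  define F where "F r = set_encode {e. e \<le> r \<and> e \<in> true_events}" for r
  have F: "set_decode (F r) = {e. e \<le> r \<and> e \<in> true_events}" for r
    unfolding F_def by (rule set_encode_inverse) simp
  obtain t where t: "\<And>r u. \<not> refuted X r (F r) (t r) i u"
    using ex_unrefuted[OF ij(1)] unfolding F_def by metis
  have "\<not> connected X k (set_decode (F r)) j i" for r
  proof
    assume "connected X k (set_decode (F r)) j i"
    then have "E_set_ce (lnth X j) (lnth X i)"
    proof (rule connected_invariant[where P = "\<lambda>a. E_set_ce (lnth X j) (lnth X a)"])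
      fix a b assume "a < ?n" "b < ?n" and a: "E_set_ce (lnth X j) (lnth X a)"
        and "matched k (set_decode (F r)) (lnth X a) (lnth X b)"
      then have "E_set_ce (lnth X a) (lnth X b)"
        using matched_mono[of k "set_decode (F r)" _ _ true_events] k unfolding F by blast
      with a show "E_set_ce (lnth X j) (lnth X b)" by (simp add: E_set_ce_def)
    qed (use ij in \<open>simp_all add: E_set_ce_def\<close>)
    with E show False by (simp add: E_set_ce_def)
  qed
  then have "range (\<lambda>r. guess r (F r) (t r) i) \<subseteq> {guess r F t q | r F t q. (\<forall>u. \<not> refuted X r F t q u) \<and>
    connected X k (set_decode F) i q \<and> \<not> connected X k (set_decode F) j q}"
    using t connected_refl by blast
  moreover have "infinite (range (\<lambda>r. guess r (F r) (t r) i))"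
    by (rule range_inj_infinite) (simp add: inj_on_def)
  ultimately show ?thesis using finite_subset by blast
qed

lemma ex_guess: "\<exists>r F t q. z = guess r F t q"
  by (metis prod_encode_pfst_psnd)

theorem theorem3p3:
  shows "fin_reducible E_set_ce E3_ce"
proof -
  obtain h where h: "computable h"
    "\<And>X i k r F t q. guess r F t q \<in> column (W (h (prod_encode (X, i)))) k \<longleftrightarrow>
       (\<exists>u. refuted X r F t q u) \<or> connected X k (set_decode F) i q"
    using obtain_reduction_index by blast
  have red: "E_set_ce (lnth X i) (lnth X j) \<longleftrightarrow> E3_ce (h (prod_encode (X, i))) (h (prod_encode (X, j)))"
    if ij: "i < length (list_decode X)" "j < length (list_decode X)" for X i j
  proof -
    let ?A = "\<lambda>i k. column (W (h (prod_encode (X, i)))) k"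
    let ?D = "\<lambda>k. {guess r F t q | r F t q. (\<forall>u. \<not> refuted X r F t q u) \<and>
      \<not> (connected X k (set_decode F) i q \<longleftrightarrow> connected X k (set_decode F) j q)}"
    have "z \<in> (?A i k - ?A j k) \<union> (?A j k - ?A i k) \<longleftrightarrow> z \<in> ?D k" for z k
    proof -
      obtain r F t q where z: "z = guess r F t q" using ex_guess by blast
      show ?thesis unfolding z by (auto simp: h(2))
    qed
    then have D: "(?A i k - ?A j k) \<union> (?A j k - ?A i k) = ?D k" for k by blast
    show ?thesis
    proof
      assume "E_set_ce (lnth X i) (lnth X j)"
      then show "E3_ce (h (prod_encode (X, i))) (h (prod_encode (X, j)))"
        unfolding E3_ce_def D using finite_disagreement[OF ij] by blast
    next
      assume "E3_ce (h (prod_encode (X, i))) (h (prod_encode (X, j)))"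
      then have fin: "finite (?D k)" for k unfolding E3_ce_def D by blast
      show "E_set_ce (lnth X i) (lnth X j)"
      proof (rule ccontr)
        assume "\<not> E_set_ce (lnth X i) (lnth X j)"
        from infinite_disagreement[OF ij this] obtain k where
          "infinite {guess r F t q | r F t q. (\<forall>u. \<not> refuted X r F t q u) \<and>
            connected X k (set_decode F) i q \<and> \<not> connected X k (set_decode F) j q}" ..
        \<comment> \<open>The infinite set is one side of the symmetric difference
          \<open>?D k\<close>.\<close>
        then have "infinite (?D k)" by (rule contrapos_nn) (erule finite_subset[rotated], blast)
        with fin show False by blast
      qed
    qed
  qed
  \<comment> \<open>The output list is found by minimisation: having the right length and the
    entries prescribed by \<open>h\<close> is a decidable property of its code.\<close>
  let ?P = "\<lambda>l X. length (list_decode l) = length (list_decode X) \<and>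
    (\<forall>i<length (list_decode X). lnth l i = h (prod_encode (X, i)))"
  define g where "g X = (LEAST l. ?P l X)" for X
  have ex: "\<exists>l. ?P l X" for X
    by (rule exI[of _ "list_encode (map (\<lambda>i. h (prod_encode (X, i))) [0..<length (list_decode X)])"]) simp
  have "computable g"
    unfolding g_def
    by (rule computable_Least[OF _ ex]) (intro computable_intros computable_compose[OF h(1)])
  moreover have g: "?P (g X) X" for X
    unfolding g_def by (rule LeastI_ex[OF ex])
  have "length (list_decode (g (list_encode xs))) = length xs \<and>
      (\<forall>i j. i < j \<and> j < length xs \<longrightarrow>
        (E_set_ce (xs ! i) (xs ! j) \<longleftrightarrow>
         E3_ce (list_decode (g (list_encode xs)) ! i) (list_decode (g (list_encode xs)) ! j)))" for xs
    using g[of "list_encode xs"] red[of _ "list_encode xs"] by (auto simp: lnth_eq)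
  ultimately show ?thesis unfolding fin_reducible_def Let_def by blast
qed

end
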